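(* Let $\mathbf{Y}=(Y_1,\dots,Y_r)'$ be a vector of $r$ response quantities and $x_1,\dots,x_p$ be $p$ predictor quantities. Assume the following. (i) The vector $\mathbf{Y}\in\mathbb{R}^r$ has a functional relationship with the $p$ predictors $(x_1,\dots,x_p)$: $$\mathbf{Y}=\mathbf{f}(x_1,\dots,x_p),\qquad(\ast)$$ where $\mathbf{f}$ is an unknown function of the predictors. (ii) The quantities $(Y_1,\dots,Y_r,x_1,\dots,x_p)$ involve $k$ fundamental dimensions labeled $L_1,\dots,L_k$, and $\mathbf{A}\subseteq\operatorname{span}(\mathbf{B})$, where $\mathbf{A}$ is the $k\times r$ dimension matrix of the responses and $\mathbf{B}$ is the $k\times p$ dimension matrix of the predictors. (iii) If $Z$ is any of $(Y_1,\dots,Y_r,x_1,\dots,x_p)$, then $[Z]=\prod_{i=1}^k L_i^{\alpha_i}$ for some $\alpha_i\in\mathbb{R}$, $i=1,\dots,k$, which are the dimension exponents of $Z$. (iv) For any set of fundamental dimensions one can choose a system of units for measuring the value of any quantity $Z$. A change from one system of units to another involves a positive scaling of each fundamental dimension, which in turn induces a scaling of each quantity $Z$. Under a change of system of units the value of a dimensionless quantity is unchanged, i.e. its value is invariant under an arbitrary scaling of the fundamental dimensions. Then: (i) Formula $(\ast)$ can be written in terms of dimensionless quantities. (ii) The number of dimensionless predictors is $p-\operatorname{rank}(\mathbf{B})$. (iii) Let $\mathbf{u}_i=(\pi_{1i},\dots,\pi_{pi})'$, $i=1,\dots,p-\operatorname{rank}(\mathbf{B})$, represent the linearly independent solutions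 of the system $\mathbf{B}\mathbf{u}_i=0$. Let $\mathbf{a}_i=(a_{1i},\dots,a_{ki})'$ be the dimension vector of the response $Y_i$, $i=1,\dots,r$, and let $\mathbf{y}_i=(\rho_{1i},\dots,\rho_{pi})'$ represent a solution of the system $\mathbf{B}\mathbf{y}_i=-\mathbf{a}_i$. Then formula $(\ast)$ simplifies to $$\tilde{\boldsymbol\pi}=\mathbf{h}(\pi_1,\dots,\pi_{p-\operatorname{rank}(\mathbf{B})}),$$ where $\tilde{\boldsymbol\pi}\in\mathbb{R}^r$, and where all elements of $\tilde{\boldsymbol\pi}$ and all $\pi_i$, $i=1,\dots,p-\operatorname{rank}(\mathbf{B})$, are dimensionless quantities.
   Context: $[Z]$ denotes the dimension of a quantity $Z$; $Z$ is dimensionless, written $[Z]=1$, if its value does not change when the units of the fundamental dimensions change. The dimension vector of $x_i$ is $\mathbf{b}_i=(b_{1i},\dots,b_{ki})'$, where $b_{ji}\in\mathbb{R}$ is the power to which the $j$-th fundamental dimension is raised in $[x_i]$, and $\mathbf{B}=(b_{ji})$ is the $k\times p$ matrix with columns $\mathbf{b}_1,\dots,\mathbf{b}_p$. Likewise the dimension vector of $Y_i$ is $\mathbf{a}_i=(a_{1i},\dots,a_{ki})'$, where $a_{ji}\in\mathbb{R}$ is the power to which the $j$-th fundamental dimension is raised in $[Y_i]$, and $\mathbf{A}=(a_{ji})$ is the $k\times r$ matrix with columns $\mathbf{a}_1,\dots,\mathbf{a}_r$. The condition $\mathbf{A}\subseteq\operatorname{span}(\mathbf{B})$ means that every column of $\mathbf{A}$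 lies in the column space of $\mathbf{B}$. The dimensionless predictors are $\pi_i=\prod_{l=1}^p x_l^{\pi_{li}}$, and the elements of $\tilde{\boldsymbol\pi}=(\tilde\pi_1,\dots,\tilde\pi_r)'$ are the dimensionless responses $\tilde\pi_i=Y_i\prod_{l=1}^p x_l^{\rho_{li}}$. Here $\mathbf{h}$ is an unknown $\mathbb{R}^r$-valued function. Assumption (iv) is understood to say that the relationship $(\ast)$ itself does not depend on the system of units: when a fundamental dimension $L_j$ is replaced by $e^{\varepsilon}L_j$, so that $Y_i$ becomes $Y_i^*=e^{a_{ji}\varepsilon}Y_i$ and $x_i$ becomes $x_i^*=e^{b_{ji}\varepsilon}x_i$, the relation $(\ast)$ holds if and only if $(Y_1^*,\dots,Y_r^* )'=\mathbf{f}(x_1^*,\dots,x_p^* )$ holds for all $\varepsilon\in\mathbb{R}$. *)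

theory Defs
  imports "HOL-Analysis.Analysis"
begin

text \<open>
  The values of \<open>n\<close> measured quantities form a vector \<open>v :: real ^ 'n\<close>. Their dimensions are recorded
  by a matrix \<open>D :: real ^ 'n ^ 'k\<close>: the quantity \<open>i\<close> has dimension
  \<open>\<Prod>j. L j powr (D $ j $ i)\<close>, so its dimension vector is \<open>column i D\<close>.
\<close>

definition positive :: "real ^ 'n \<Rightarrow> bool" where
  "positive v \<longleftrightarrow> (\<forall>i. 0 < v $ i)"

text \<open>
  Values after an arbitrary change of the system of units: the fundamental dimension \<open>j\<close> is scaled
  by \<open>s $ j > 0\<close>.
\<close>

definition change_units :: "real ^ 'n ^ 'k \<Rightarrow> real ^ 'k \<Rightarrow> real ^ 'n \<Rightarrow> real ^ 'n" where
  "change_units D s v = (\<chi> i. (\<Prod>j\<in>UNIV. (s $ j) powr (D $ j $ i)) * v $ i)"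

text \<open>
  The special case in which only \<open>j\<close> is rescaled, by the factor \<open>exp \<epsilon>\<close>.
\<close>

definition scale_dimension :: "real ^ 'n ^ 'k \<Rightarrow> 'k \<Rightarrow> real \<Rightarrow> real ^ 'n \<Rightarrow> real ^ 'n" where
  "scale_dimension D j \<epsilon> v = (\<chi> i. exp (D $ j $ i * \<epsilon>) * v $ i)"

text \<open>
  The relation \<open>y = f x\<close> between predictors \<open>x\<close> (dimension matrix \<open>B\<close>) and responses \<open>y\<close>
  (dimension matrix \<open>A\<close>) does not depend on the system of units. Here and below the predictors are
  positive, as real powers of them are formed; the responses are arbitrary real numbers.
\<close>

definition unit_free_relation ::
    "real ^ 'r ^ 'k \<Rightarrow> real ^ 'p ^ 'k \<Rightarrow> (real ^ 'p \<Rightarrow> real ^ 'r) \<Rightarrow> bool" where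
  "unit_free_relation A B f \<longleftrightarrow>
     (\<forall>j \<epsilon> x y. positive x \<longrightarrow>
        (y = f x \<longleftrightarrow> scale_dimension A j \<epsilon> y = f (scale_dimension B j \<epsilon> x)))"

text \<open>
  A derived quantity \<open>Z\<close>, computed from the values of the predictors and the responses, is
  dimensionless if no change of units affects its value.
\<close>

definition dimensionless ::
    "real ^ 'r ^ 'k \<Rightarrow> real ^ 'p ^ 'k \<Rightarrow> (real ^ 'p \<Rightarrow> real ^ 'r \<Rightarrow> real) \<Rightarrow> bool" where
  "dimensionless A B Z \<longleftrightarrow>
     (\<forall>s x y. positive s \<longrightarrow> positive x \<longrightarrow>
        Z (change_units B s x) (change_units A s y) = Z x y)"

definition power_product :: "real ^ 'p \<Rightarrow> real ^ 'p \<Rightarrow> real" where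
  "power_product u x = (\<Prod>l\<in>UNIV. (x $ l) powr (u $ l))"

definition predictor_product :: "real ^ 'p \<Rightarrow> real ^ 'p \<Rightarrow> real ^ 'r \<Rightarrow> real" where
  "predictor_product u x y = power_product u x"

definition response_product :: "('r \<Rightarrow> real ^ 'p) \<Rightarrow> 'r \<Rightarrow> real ^ 'p \<Rightarrow> real ^ 'r \<Rightarrow> real" where
  "response_product \<rho> i x y = y $ i * power_product (\<rho> i) x"

text \<open>
  Since \<open>m\<close> is a term and may be \<open>0\<close>, an \<open>m\<close>-tuple of vectors is given by \<open>u 0, \<dots>, u (m - 1)\<close> for a
  sequence \<open>u\<close>, and an argument tuple of \<open>h\<close> by a list of length \<open>m\<close>.
\<close>

definition independent_family :: "nat \<Rightarrow> (nat \<Rightarrow> 'v::real_vector) \<Rightarrow> bool" where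
  "independent_family m u \<longleftrightarrow> inj_on u {..<m} \<and> independent (u ` {..<m})"

text \<open>
  A full system of dimensionless predictors: products of powers of the predictors which are
  dimensionless, have independent exponent vectors, and from which every dimensionless product of
  powers of the predictors arises as a product of powers.
\<close>

definition full_dimensionless_predictors ::
    "real ^ 'r ^ 'k \<Rightarrow> real ^ 'p ^ 'k \<Rightarrow> nat \<Rightarrow> (nat \<Rightarrow> real ^ 'p) \<Rightarrow> bool" where
  "full_dimensionless_predictors A B m u \<longleftrightarrow>
     (\<forall>i<m. dimensionless A B (predictor_product (u i))) \<and>
     independent_family m u \<and>
     (\<forall>v. dimensionless A B (predictor_product v) \<longrightarrow> v \<in> span (u ` {..<m}))"

text \<open>
  The relation \<open>y = f x\<close> is written as a functional relationship \<open>h\<close> between the \<open>m\<close> dimensionless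
  predictors with exponents \<open>u\<close> and the dimensionless responses with exponents \<open>\<rho>\<close>.
\<close>

definition dimensionless_form ::
    "real ^ 'r ^ 'k \<Rightarrow> real ^ 'p ^ 'k \<Rightarrow> (real ^ 'p \<Rightarrow> real ^ 'r) \<Rightarrow>
     nat \<Rightarrow> (nat \<Rightarrow> real ^ 'p) \<Rightarrow> ('r \<Rightarrow> real ^ 'p) \<Rightarrow> (real list \<Rightarrow> real ^ 'r) \<Rightarrow> bool" where
  "dimensionless_form A B f m u \<rho> h \<longleftrightarrow>
     (\<forall>i<m. dimensionless A B (predictor_product (u i))) \<and>
     (\<forall>i. dimensionless A B (response_product \<rho> i)) \<and>
     (\<forall>x y. positive x \<longrightarrow>
        (y = f x \<longleftrightarrow>
         (\<chi> i. response_product \<rho> i x y) = h (map (\<lambda>i. predictor_product (u i) x y) [0..<m])))"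

end

theory Submission
  imports Defs
begin

text \<open>
  In logarithmic coordinates \<open>x = exp w\<close> a change of units \<open>s = exp t\<close> is the translation
  \<open>w \<mapsto> w + t B\<close>, and a product of powers with exponents \<open>v\<close> is the linear form \<open>w \<mapsto> v \<bullet> w\<close>.
  So a product of powers is dimensionless iff \<open>B v = 0\<close>, and the count is the rank-nullity theorem.
  If all dimensionless predictors agree at \<open>exp w\<close> and \<open>exp w'\<close>, then \<open>w - w'\<close> is orthogonal to
  the kernel of \<open>B\<close>, hence is \<open>t B\<close> for some \<open>t\<close>: the two points differ by a change of units, and
  the dimensionless responses of \<open>f\<close> agree there. They are therefore a function \<open>h\<close> of the
  dimensionless predictors.
\<close>

subsection \<open>Logarithmic coordinates\<close>

definition exp_vec :: "real ^ 'n \<Rightarrow> real ^ 'n" where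
  "exp_vec w = (\<chi> i. exp (w $ i))"

lemma exp_vec_nth [simp]: "exp_vec w $ i = exp (w $ i)"
  by (simp add: exp_vec_def)

lemma positive_exp_vec [simp]: "positive (exp_vec w)"
  by (simp add: positive_def)

lemma positive_cases:
  assumes "positive x"
  obtains w where "x = exp_vec w"
proof
  show "x = exp_vec (\<chi> i. ln (x $ i))"
    using assms by (simp add: vec_eq_iff positive_def)
qed

lemma change_units_exp_vec_nth:
  "change_units D (exp_vec t) v $ i = exp ((t v* D) $ i) * v $ i"
  by (simp add: change_units_def powr_def exp_sum vector_matrix_mult_def mult.commute)

lemma change_units_exp_vec: "change_units D (exp_vec t) (exp_vec w) = exp_vec (t v* D + w)"
  by (simp add: vec_eq_iff change_units_exp_vec_nth exp_add)

lemma change_units_exp_vec_add: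
  "change_units D (exp_vec (s + t)) v = change_units D (exp_vec s) (change_units D (exp_vec t) v)"
  by (simp add: vec_eq_iff change_units_exp_vec_nth vector_matrix_mult_def ring_distribs
      sum.distrib exp_add)

text \<open>Links the one-dimension rescalings in \<open>unit_free_relation\<close> to general
  changes of units: they are those along a coordinate axis of \<open>t\<close>.\<close>

lemma scale_dimension_eq_change_units:
  "scale_dimension D j \<epsilon> v = change_units D (exp_vec (\<epsilon> *\<^sub>R axis j 1)) v"
proof -
  have "((\<epsilon> *\<^sub>R axis j 1) v* D) $ i = D $ j $ i * \<epsilon>" for i
    by (simp add: vector_matrix_mult_def axis_def if_distrib if_distribR cong: if_cong)
  then show ?thesis
    by (simp add: vec_eq_iff scale_dimension_def change_units_exp_vec_nth)
qed

lemma power_product_exp_vec: "power_product u (exp_vec w) = exp (u \<bullet> w)"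
  by (simp add: power_product_def powr_def exp_sum inner_vec_def)

lemma power_product_pos:
  assumes "positive x"
  shows "0 < power_product u x"
  using assms by (auto elim!: positive_cases simp: power_product_exp_vec)

text \<open>By adjointness, pairing the translation \<open>t v* B\<close> with \<open>u\<close>
  equals pairing \<open>t\<close> with \<open>B *v u\<close>.\<close>

lemma power_product_change_units:
  "power_product u (change_units B (exp_vec t) (exp_vec w)) =
     exp (t \<bullet> (B *v u)) * power_product u (exp_vec w)"
  by (simp add: change_units_exp_vec power_product_exp_vec inner_add_right exp_add
      flip: dot_lmul_matrix) (simp add: inner_commute)

subsection \<open>Dimensionless products\<close>

lemma dimensionless_predictor_product_iff:
  fixes A :: "real ^ 'r ^ 'k" and B :: "real ^ 'p ^ 'k"
  shows "dimensionless A B (predictor_product u) \<longleftrightarrow> B *v u = 0"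
proof
  assume dim: "dimensionless A B (predictor_product u)"
  have "t \<bullet> (B *v u) = 0" for t
  proof -
    \<comment> \<open>At the all-ones point \<open>exp_vec 0\<close> every power product is 1, so
      invariance there reads \<open>exp (t \<bullet> (B *v u)) = 1\<close>.\<close>
    have "predictor_product u (change_units B (exp_vec t) (exp_vec 0))
            (change_units A (exp_vec t) (0 :: real ^ 'r)) = predictor_product u (exp_vec 0) (0 :: real ^ 'r)"
      using dim unfolding dimensionless_def by (meson positive_exp_vec)
    then show ?thesis
      by (simp add: predictor_product_def power_product_change_units)
        (simp add: power_product_exp_vec)
  qed
  then show "B *v u = 0"
    by (metis inner_eq_zero_iff)
next
  assume "B *v u = 0"
  then show "dimensionless A B (predictor_product u)"
    by (auto simp: dimensionless_def predictor_product_def power_product_change_units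
        elim!: positive_cases)
qed

text \<open>The response gains the factor \<open>exp (t \<bullet> column i A)\<close>, the power
  product its inverse.\<close>

lemma dimensionless_response_product:
  assumes "B *v \<rho> i = - column i A"
  shows "dimensionless A B (response_product \<rho> i)"
proof -
  have "(t v* A) $ i = t \<bullet> column i A" for t
    by (simp add: vector_matrix_mult_def inner_vec_def column_def mult.commute)
  then show ?thesis
    using assms by (auto simp: dimensionless_def response_product_def power_product_change_units
        change_units_exp_vec_nth exp_minus elim!: positive_cases)
qed

text \<open>Invariance is assumed for one fundamental dimension at a time. Expanding
  \<open>t\<close> in the standard basis composes a general change from such steps; every
  intermediate point stays positive, so the assumption applies to each.\<close>

lemma unit_free_change_units:
  assumes "unit_free_relation A B f"
  shows "f (change_units B (exp_vec t) (exp_vec w)) = change_units A (exp_vec t) (f (exp_vec w))"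
proof -
  have "f (change_units B (exp_vec (\<Sum>j\<in>J. t $ j *\<^sub>R axis j 1)) (exp_vec w)) =
          change_units A (exp_vec (\<Sum>j\<in>J. t $ j *\<^sub>R axis j 1)) (f (exp_vec w))"
    if "finite J" for J
    using that
  proof (induction J)
    case empty
    show ?case
      by (simp add: vec_eq_iff change_units_exp_vec_nth change_units_exp_vec)
  next
    case (insert j J)
    have "f (change_units B (exp_vec (t $ j *\<^sub>R axis j 1)) x) =
            change_units A (exp_vec (t $ j *\<^sub>R axis j 1)) (f x)" if "positive x" for x
      using assms that by (metis unit_free_relation_def scale_dimension_eq_change_units)
    moreover have "positive (change_units B (exp_vec s) (exp_vec w))" for s
      by (simp add: change_units_exp_vec)
    ultimately show ?case
      using insert by (simp add: change_units_exp_vec_add)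
  qed
  from this[of UNIV] show ?thesis
    using basis_expansion[of t] by (simp add: scalar_mult_eq_scaleR)
qed

subsection \<open>The null space of the dimension matrix\<close>

text \<open>The null space is the orthogonal complement of the row space, whose dimension is
  \<open>rank (transpose B) = rank B\<close>.\<close>

lemma dim_null_space:
  fixes B :: "real ^ 'p ^ 'k"
  shows "dim {v. B *v v = 0} = CARD('p) - rank B"
proof -
  have "{v. B *v v = 0} = {y \<in> UNIV. \<forall>x\<in>range ((*v) (transpose B)). orthogonal x y}"
    using ker_orthogonal_comp_adjoint[of "(*v) B"]
    by (auto simp: adjoint_matrix orthogonal_comp_def vimage_def)
  moreover have "subspace (range ((*v) (transpose B)))"
    by (intro linear_subspace_image) auto
  ultimately have "dim {v. B *v v = 0} + rank (transpose B) = CARD('p)"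
    using dim_subspace_orthogonal_to_vectors[of "range ((*v) (transpose B))" UNIV]
    by (simp add: rank_dim_range)
  then show ?thesis
    by (simp add: rank_transpose)
qed

text \<open>The row space is a subspace of a finite-dimensional space, hence equals its double
  orthogonal complement, that is, the complement of the null space.\<close>

lemma orthogonal_null_space:
  fixes B :: "real ^ 'p ^ 'k"
  assumes "\<And>v. B *v v = 0 \<Longrightarrow> v \<bullet> w = 0"
  obtains t where "w = t v* B"
proof -
  have "subspace (range ((*v) (transpose B)))"
    by (intro linear_subspace_image) auto
  moreover have "w \<in> orthogonal_comp ((*v) B -` {0})"
    using assms by (auto simp: orthogonal_comp_def orthogonal_def)
  ultimately have "w \<in> range ((*v) (transpose B))"
    using ker_orthogonal_comp_adjoint[of "(*v) B"]
    by (simp add: adjoint_matrix orthogonal_comp_self)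
  then show ?thesis
    using that by auto
qed

lemma independent_family_card:
  "independent_family m u \<Longrightarrow> card (u ` {..<m}) = m"
  by (simp add: independent_family_def card_image)

lemma independent_family_dim:
  "independent_family m u \<Longrightarrow> dim (u ` {..<m}) = m"
  by (metis dim_eq_card_independent independent_family_card independent_family_def)

lemma independent_family_span:
  fixes S :: "'v::euclidean_space set"
  assumes "independent_family (dim S) u" "subspace S" "\<And>i. i < dim S \<Longrightarrow> u i \<in> S"
  shows "span (u ` {..<dim S}) = S"
  using assms by (intro subspace_dim_equal span_minimal) (auto simp: independent_family_dim)

lemma independent_family_exists:
  fixes S :: "'v::euclidean_space set"
  obtains u where "independent_family (dim S) u" "\<And>i. i < dim S \<Longrightarrow> u i \<in> S"
proof -
  obtain b where b: "b \<subseteq> S" "independent b" "S \<subseteq> span b" "card b = dim S"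
    by (rule basis_exists)
  then obtain u where "bij_betw u {..<dim S} b"
    using ex_bij_betw_nat_finite[OF independent_imp_finite[OF b(2)]]
    by (metis atLeast0LessThan)
  with b(1,2) have "independent_family (dim S) u" "\<And>i. i < dim S \<Longrightarrow> u i \<in> S"
    by (auto simp: independent_family_def bij_betw_def)
  then show ?thesis
    by (rule that)
qed

lemma subspace_null_space: "subspace {v. (B :: real ^ 'p ^ 'k) *v v = 0}"
  by (intro linear_subspace_kernel) auto

text \<open>Dimensionlessness of the \<open>u i\<close> gives one inclusion between the span and the
  null space, completeness of the system the other.\<close>

lemma full_dimensionless_predictors_iff:
  fixes A :: "real ^ 'r ^ 'k" and B :: "real ^ 'p ^ 'k"
  shows "full_dimensionless_predictors A B m u \<longleftrightarrow>
    independent_family m u \<and> span (u ` {..<m}) = {v. B *v v = 0}"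
proof -
  have "(\<forall>i<m. B *v u i = 0) \<longleftrightarrow> span (u ` {..<m}) \<subseteq> {v. B *v v = 0}"
    using span_superset[of "u ` {..<m}"] span_minimal[OF _ subspace_null_space[of B], of "u ` {..<m}"]
    by blast
  then show ?thesis
    by (auto simp: full_dimensionless_predictors_def dimensionless_predictor_product_iff)
qed

subsection \<open>The dimensionless form\<close>

lemma dimensionless_responses_determined:
  fixes A :: "real ^ 'r ^ 'k" and B :: "real ^ 'p ^ 'k"
  assumes f: "unit_free_relation A B f"
    and span: "span (u ` {..<m}) = {v. B *v v = 0}"
    and \<rho>: "\<And>i. B *v \<rho> i = - column i A"
    and pos: "positive x" "positive x'"
    and eq: "\<And>i. i < m \<Longrightarrow> power_product (u i) x = power_product (u i) x'"
  shows "response_product \<rho> i x (f x) = response_product \<rho> i x' (f x')"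
proof -
  obtain w w' where w: "x = exp_vec w" "x' = exp_vec w'"
    using pos by (metis positive_cases)
  \<comment> \<open>Equal predictor values mean orthogonality to each \<open>u i\<close>; this
    passes to their span, the whole null space.\<close>
  have "orthogonal (w - w') v" if "B *v v = 0" for v
  proof (rule orthogonal_to_span)
    show "v \<in> span (u ` {..<m})"
      using that span by simp
  next
    fix y assume "y \<in> u ` {..<m}"
    then show "orthogonal (w - w') y"
      using eq by (auto simp: w power_product_exp_vec orthogonal_def inner_commute inner_diff_right)
  qed
  then obtain t where "w - w' = t v* B"
    by (metis orthogonal_null_space orthogonal_def inner_commute)
  then have x: "x = change_units B (exp_vec t) x'"
    by (simp add: w change_units_exp_vec flip: \<open>w - w' = t v* B\<close>)
  then have "f x = change_units A (exp_vec t) (f x')"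
    using unit_free_change_units[OF f] by (simp add: w)
  with x show ?thesis
    using dimensionless_response_product[of B \<rho> i A, OF \<rho>] pos
    by (metis dimensionless_def positive_exp_vec)
qed

lemma dimensionless_form_exists:
  fixes A :: "real ^ 'r ^ 'k" and B :: "real ^ 'p ^ 'k"
  assumes f: "unit_free_relation A B f"
    and span: "span (u ` {..<m}) = {v. B *v v = 0}"
    and \<rho>: "\<And>i. B *v \<rho> i = - column i A"
  shows "\<exists>h. dimensionless_form A B f m u \<rho> h"
proof -
  define P where "P x = map (\<lambda>i. power_product (u i) x) [0..<m]" for x
  define R where "R x = (\<chi> i. response_product \<rho> i x (f x))" for x
  \<comment> \<open>Any positive point with the given predictor values may serve as representative.
    Lists that no positive point attains get an unspecified value, but \<open>h\<close> is only
    evaluated at lists \<open>P x\<close>.\<close>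
  define h where "h ps = R (SOME x. positive x \<and> P x = ps)" for ps
  have h: "h (P x) = R x" if "positive x" for x
  proof -
    define x' where "x' = (SOME x'. positive x' \<and> P x' = P x)"
    have "positive x' \<and> P x' = P x"
      unfolding x'_def by (rule someI[of _ x]) (use that in simp)
    then have "response_product \<rho> i x' (f x') = response_product \<rho> i x (f x)" for i
      using that by (intro dimensionless_responses_determined[OF f span \<rho>]) (auto simp: P_def)
    then show ?thesis
      by (simp add: h_def R_def x'_def[symmetric])
  qed
  \<comment> \<open>For the converse direction, the positive power product is cancelled from each
    response.\<close>
  have "y = f x \<longleftrightarrow> (\<chi> i. response_product \<rho> i x y) = h (P x)" if "positive x" for x y
    using power_product_pos[OF that]
    by (auto simp: h[OF that] R_def vec_eq_iff response_product_def) (metis less_irrefl)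
  moreover have "u i \<in> span (u ` {..<m})" if "i < m" for i
    using that by (simp add: span_base)
  ultimately have "dimensionless_form A B f m u \<rho> h"
    using dimensionless_response_product[of B \<rho> _ A, OF \<rho>] span
    by (auto simp: dimensionless_form_def dimensionless_predictor_product_iff predictor_product_def
        P_def)
  then show ?thesis
    by blast
qed

text \<open>The span of the columns lies in the range of \<open>B\<close>, so each column of
  \<open>A\<close> has a preimage, which is then negated.\<close>

lemma response_exponents_exist:
  fixes A :: "real ^ 'r ^ 'k" and B :: "real ^ 'p ^ 'k"
  assumes "columns A \<subseteq> span (columns B)"
  obtains \<rho> where "\<And>i. B *v \<rho> i = - column i A"
proof -
  have "span (columns B) \<subseteq> range ((*v) B)"
    by (intro span_minimal linear_subspace_image) (auto simp: columns_image_basis)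
  then have "\<forall>i. \<exists>y. column i A = B *v y"
    using assms by (auto simp: columns_def)
  then obtain y where "\<And>i. column i A = B *v y i"
    by metis
  then have "B *v (- y i) = - column i A" for i
    by (metis diff_0 matrix_vector_mult_0_right matrix_vector_mult_diff_distrib)
  then show ?thesis
    by (rule that)
qed

theorem theorem1:
  fixes A :: "real ^ 'r ^ 'k"
    and B :: "real ^ 'p ^ 'k"
    and f :: "real ^ 'p \<Rightarrow> real ^ 'r"
  assumes span: "columns A \<subseteq> span (columns B)"
    and unit_free: "unit_free_relation A B f"
  shows "(\<exists>m u \<rho> h. dimensionless_form A B f m u \<rho> h) \<and>
         ((\<exists>m u. full_dimensionless_predictors A B m u) \<and>
          (\<forall>m u. full_dimensionless_predictors A B m u \<longrightarrow> m = CARD('p) - rank B)) \<and>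
         (\<forall>u \<rho>. independent_family (CARD('p) - rank B) u \<longrightarrow>
                (\<forall>i < CARD('p) - rank B. B *v u i = 0) \<longrightarrow>
                (\<forall>i. B *v \<rho> i = - column i A) \<longrightarrow>
                (\<exists>h. dimensionless_form A B f (CARD('p) - rank B) u \<rho> h))"
proof (intro conjI allI impI)
  have dim: "dim {v. B *v v = 0} = CARD('p) - rank B"
    by (rule dim_null_space)
  have spanning: "span (u ` {..<CARD('p) - rank B}) = {v. B *v v = 0}"
    if "independent_family (CARD('p) - rank B) u" "\<forall>i < CARD('p) - rank B. B *v u i = 0" for u
    using independent_family_span[of "{v. B *v v = 0}" u] subspace_null_space[of B] that
    by (simp add: dim)
  obtain u where u: "independent_family (CARD('p) - rank B) u"
      "\<forall>i < CARD('p) - rank B. B *v u i = 0"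
    using independent_family_exists[of "{v. B *v v = 0}"] by (auto simp: dim)
  obtain \<rho> where \<rho>: "\<And>i. B *v \<rho> i = - column i A"
    using response_exponents_exist[OF span] by blast
  show "\<exists>m u \<rho> h. dimensionless_form A B f m u \<rho> h"
    using dimensionless_form_exists[OF unit_free spanning[OF u], of \<rho>] \<rho> by blast
  show "\<exists>m u. full_dimensionless_predictors A B m u"
    using u spanning[OF u] by (auto simp: full_dimensionless_predictors_iff)
  \<comment> \<open>Both sides are the dimension of the null space: \<open>m\<close> independent
    vectors span it.\<close>
  show "m = CARD('p) - rank B" if "full_dimensionless_predictors A B m u" for m u
    using that independent_family_dim[of m u] dim_span[of "u ` {..<m}"]
    by (simp add: full_dimensionless_predictors_iff dim)
  show "\<exists>h. dimensionless_form A B f (CARD('p) - rank B) u \<rho> h"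
    if "independent_family (CARD('p) - rank B) u" "\<forall>i < CARD('p) - rank B. B *v u i = 0"
      "\<forall>i. B *v \<rho> i = - column i A" for u \<rho>
    using dimensionless_form_exists[OF unit_free spanning[OF that(1,2)], of \<rho>] that(3) by blast
qed

end
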